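(* Let $p\in\mathbf{N}_0$, $f\in C_p$, and let $(\beta_n)_{n\ge1}$ be a sequence with $0\le\beta_n<1$ and $\beta_n\to0$ as $n\to\infty$. Then $$\lim_{n\to\infty}J_n^{[\beta_n]}(f;a_n,b_n;x)=f(x)\qquad\text{for every } x\in\mathbf{R}_0.$$ Furthermore, this convergence is uniform in $x$ on every interval $[x_1,x_2]$ with $x_2>x_1\ge0$.
   Context: $\mathbf{R}_0=[0,\infty)$, $\mathbf{N}=\{1,2,\dots\}$, $\mathbf{N}_0=\mathbf{N}\cup\{0\}$. Throughout, $(a_n)_{n\ge1}$ and $(b_n)_{n\ge1}$ are given increasing unbounded real sequences with $a_n\ge1$, $b_n\ge1$, such that $(a_n/b_n)_{n\ge1}$ is non-decreasing and $a_n/b_n=1+o(1/b_n)$ as $n\to\infty$. For $0\le\beta<1$, $\alpha\in\mathbf{R}_0$, $k\in\mathbf{N}_0$ put $$\omega_\beta(k,\alpha)=\frac{\alpha}{k!}(\alpha+k\beta)^{k-1}e^{-(\alpha+k\beta)},$$ with $\omega_\beta(0,\alpha)=e^{-\alpha}$ (in particular $\omega_\beta(0,0)=1$) and $\omega_\beta(k,0)=0$ for $k\ge1$. The operators are $$J_n^{[\beta]}(f;a_n,b_n;x)=\sum_{k=0}^\infty \omega_\beta(k,a_nx)\,f\!\left(\frac{k}{b_n}\right),\qquad x\in\mathbf{R}_0,\ n\in\mathbf{N}.$$ Weights: $\omega_0(x)=1$ and $\omega_p(x)=(1+x^p)^{-1}$ for $p\ge1$, $x\in\mathbf{R}_0$.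 $C_p$ is the set of all $f:\mathbf{R}_0\to\mathbf{R}$ for which $f\omega_p$ is bounded and uniformly continuous on $\mathbf{R}_0$. *)

theory Defs
  imports "HOL-Analysis.Analysis" "HOL-Library.Landau_Symbols"
begin

text \<open>The generalised Poisson probabilities. For \<open>k = 0\<close> the general formula
  \<open>\<alpha> / k! * (\<alpha> + k * \<beta>) ^ (k - 1) * exp (- (\<alpha> + k * \<beta>))\<close> has exponent \<open>-1\<close>, which natural
  number subtraction would truncate; the intended value there is \<open>exp (- \<alpha>)\<close>, also for
  \<open>\<alpha> = 0\<close>.\<close>

definition gen_poisson :: "real \<Rightarrow> nat \<Rightarrow> real \<Rightarrow> real" where
  "gen_poisson \<beta> k \<alpha> =
     (if k = 0 then exp (- \<alpha>)
      else \<alpha> / fact k * (\<alpha> + real k * \<beta>) ^ (k - 1) * exp (- (\<alpha> + real k * \<beta>)))"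

text \<open>\<open>J \<beta> f (a n) (b n) x\<close> is \<open>J\<^sub>n\<^sup>[\<^sup>\<beta>\<^sup>](f; a\<^sub>n, b\<^sub>n; x)\<close>: the operator depends on \<open>n\<close> only
  through the two numbers \<open>a\<^sub>n\<close> and \<open>b\<^sub>n\<close>.\<close>

definition J :: "real \<Rightarrow> (real \<Rightarrow> real) \<Rightarrow> real \<Rightarrow> real \<Rightarrow> real \<Rightarrow> real" where
  "J \<beta> f A B x = (\<Sum>k. gen_poisson \<beta> k (A * x) * f (real k / B))"

definition weight :: "nat \<Rightarrow> real \<Rightarrow> real" where
  "weight p x = (if p = 0 then 1 else 1 / (1 + x ^ p))"

text \<open>Functions on the half-line are represented by total functions on the reals whose values
  at negative arguments are irrelevant.\<close>

definition C :: "nat \<Rightarrow> (real \<Rightarrow> real) set" where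
  "C p = {f. bounded ((\<lambda>x. f x * weight p x) ` {0..}) \<and>
             uniformly_continuous_on {0..} (\<lambda>x. f x * weight p x)}"

end

theory Submission
  imports Defs
begin

text \<open>
  The proof is a Korovkin argument with the test functions \<open>1\<close>, \<open>exp y\<close> and \<open>exp (2 * y)\<close>.
  Exponentials suit the operators for two reasons. They dominate every polynomial, so one set of
  test functions serves all classes \<open>C p\<close>: uniformly for \<open>x\<close> in a bounded interval,
  \<open>\<bar>f y - f x\<bar> \<le> e + K * (exp y - exp x)\<^sup>2\<close> for all \<open>y \<ge> 0\<close> (\<open>increment_le_exp_square\<close>). And
  their images can be computed without any calculus of moments: the weights \<open>gen_poisson \<beta> k \<alpha>\<close>
  form an exponential family, because replacing \<open>(\<alpha>, \<beta>)\<close> by \<open>(t * \<alpha>, t * \<beta>)\<close> multiplies the weight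
  by \<open>exp (- ((t - 1) * \<alpha>)) * (t * exp (- ((t - 1) * \<beta>))) ^ k\<close>. So knowing that the weights have
  total mass one for all small \<open>\<beta>\<close> already gives their moment generating function
  (\<open>gen_poisson_exponential_moment\<close>).

  Total mass one is Abel's identity. Expanding \<open>exp (- (\<alpha> + k * \<beta>))\<close> turns the sum of the weights
  into a double series, whose terms of total degree \<open>m > 0\<close> form an \<open>m\<close>-th finite difference of a
  polynomial of degree \<open>m - 1\<close> and hence vanish. The double series converges absolutely for small
  \<open>\<beta>\<close>, and this is enough since \<open>\<beta>\<^sub>n \<rightarrow> 0\<close>.

  The image of \<open>exp (c * y)\<close> is \<open>exp (s * a\<^sub>n * x)\<close>, where \<open>s\<close> solves \<open>ln (1 + s) - s * \<beta>\<^sub>n = c / b\<^sub>n\<close>.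
  Since \<open>s\<close> is asymptotic to \<open>c / b\<^sub>n\<close> and \<open>a\<^sub>n / b\<^sub>n \<rightarrow> 1\<close>, the rate \<open>s * a\<^sub>n\<close> tends to \<open>c\<close>, so the
  images converge uniformly on bounded intervals, and the image of \<open>(exp y - exp x)\<^sup>2\<close> at \<open>x\<close>
  tends to zero.
\<close>

section \<open>Finite differences of polynomials\<close>

lemma alternating_binomial_sum_Suc:
  fixes g :: "nat \<Rightarrow> real"
  shows "(\<Sum>k\<le>Suc m. (-1) ^ k * real (Suc m choose k) * g k) =
         (\<Sum>k\<le>m. (-1) ^ k * real (m choose k) * (g k - g (Suc k)))"
proof -
  have "(\<Sum>k\<le>m. (-1) ^ k * real (m choose k) * g k)
      = (\<Sum>k\<le>Suc m. (-1) ^ k * real (m choose k) * g k)"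
    by simp
  also have "\<dots> = g 0 + (\<Sum>k\<le>m. (-1) ^ Suc k * real (m choose Suc k) * g (Suc k))"
    by (subst sum.atMost_Suc_shift) simp
  finally have shift: "g 0 + (\<Sum>k\<le>m. (-1) ^ Suc k * real (m choose Suc k) * g (Suc k))
      = (\<Sum>k\<le>m. (-1) ^ k * real (m choose k) * g k)" ..
  have "(\<Sum>k\<le>Suc m. (-1) ^ k * real (Suc m choose k) * g k)
      = g 0 + (\<Sum>k\<le>m. (-1) ^ Suc k * real (Suc m choose Suc k) * g (Suc k))"
    by (subst sum.atMost_Suc_shift) simp
  also have "\<dots> = (g 0 + (\<Sum>k\<le>m. (-1) ^ Suc k * real (m choose Suc k) * g (Suc k)))
      - (\<Sum>k\<le>m. (-1) ^ k * real (m choose k) * g (Suc k))"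
    by (simp add: sum_subtractf[symmetric] sum.distrib[symmetric] algebra_simps)
  finally show ?thesis
    unfolding shift by (simp add: sum_subtractf[symmetric] right_diff_distrib)
qed

text \<open>A first difference lowers the degree of a polynomial, so \<open>m\<close> differences annihilate degree
  below \<open>m\<close>. The induction splits off one difference and expands it binomially into powers of
  lower degree.\<close>

lemma alternating_binomial_sum_power_eq_0:
  fixes x y :: real
  assumes "d < m"
  shows "(\<Sum>k\<le>m. (-1) ^ k * real (m choose k) * (x + real k * y) ^ d) = 0"
  using assms
proof (induction m arbitrary: d)
  case (Suc m)
  have diff: "(x + real k * y) ^ d - (x + real (Suc k) * y) ^ d
      = - (\<Sum>i<d. real (d choose i) * y ^ (d - i) * (x + real k * y) ^ i)" for k
  proof -
    have "(x + real (Suc k) * y) ^ d = ((x + real k * y) + y) ^ d"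
      by (simp add: algebra_simps)
    also have "\<dots> = (\<Sum>i\<le>d. real (d choose i) * (x + real k * y) ^ i * y ^ (d - i))"
      by (rule binomial_ring)
    also have "\<dots> = (\<Sum>i<d. real (d choose i) * y ^ (d - i) * (x + real k * y) ^ i)
        + (x + real k * y) ^ d"
      by (simp add: lessThan_Suc_atMost[symmetric] mult_ac)
    finally show ?thesis by simp
  qed
  have "(\<Sum>k\<le>Suc m. (-1) ^ k * real (Suc m choose k) * (x + real k * y) ^ d)
      = (\<Sum>k\<le>m. \<Sum>i<d. - (real (d choose i) * y ^ (d - i)) *
            ((-1) ^ k * real (m choose k) * (x + real k * y) ^ i))"
    unfolding alternating_binomial_sum_Suc diff
    by (simp add: sum_distrib_left sum_negf[symmetric] mult_ac)
  also have "\<dots> = (\<Sum>i<d. - (real (d choose i) * y ^ (d - i)) *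
            (\<Sum>k\<le>m. (-1) ^ k * real (m choose k) * (x + real k * y) ^ i))"
    unfolding sum_distrib_left by (rule sum.swap)
  also have "\<dots> = 0"
    using Suc by (intro sum.neutral) auto
  finally show ?case .
qed simp

section \<open>Abel's identity: total mass one for small parameters\<close>

text \<open>The part of the weight left after the exponential is split off; it is polynomial in \<open>\<alpha>\<close> and
  \<open>\<beta>\<close>, with \<open>\<alpha> * \<alpha> powi (-1)\<close> read as \<open>1\<close> at \<open>k = 0\<close>.\<close>

definition gp_coeff :: "real \<Rightarrow> nat \<Rightarrow> real \<Rightarrow> real" where
  "gp_coeff \<beta> k \<alpha> = (if k = 0 then 1 else \<alpha> / fact k * (\<alpha> + real k * \<beta>) ^ (k - 1))"

lemma gen_poisson_eq_coeff: "gen_poisson \<beta> k \<alpha> = gp_coeff \<beta> k \<alpha> * exp (- (\<alpha> + real k * \<beta>))"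
  by (simp add: gen_poisson_def gp_coeff_def)

lemma gp_coeff_nonneg: "0 \<le> \<beta> \<Longrightarrow> 0 \<le> \<alpha> \<Longrightarrow> 0 \<le> gp_coeff \<beta> k \<alpha>"
  by (simp add: gp_coeff_def)

lemma gen_poisson_nonneg: "0 \<le> \<beta> \<Longrightarrow> 0 \<le> \<alpha> \<Longrightarrow> 0 \<le> gen_poisson \<beta> k \<alpha>"
  by (simp add: gen_poisson_eq_coeff gp_coeff_nonneg)

lemma power_le_fact_exp:
  fixes z :: real
  assumes "0 \<le> z"
  shows "z ^ k \<le> fact k * exp z"
proof -
  have "(\<Sum>i\<in>{k}. z ^ i /\<^sub>R fact i) \<le> (\<Sum>i. z ^ i /\<^sub>R fact i)"
    using assms by (intro sum_le_suminf summable_exp_generic) auto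
  then show ?thesis
    by (simp add: exp_def field_simps)
qed

text \<open>This is absolute convergence of the double series behind Abel's identity, the sign of the
  exponent being positive because the exponential series is taken in absolute value. With
  \<open>z = \<alpha> + k * \<beta>\<close> the terms are at most \<open>z ^ k / k! * exp z\<close>, and \<open>(2 * z) ^ k / k! \<le> exp (2 * z)\<close>
  bounds this by \<open>exp (3 * z) / 2 ^ k\<close>. The bound \<open>1/6\<close> on \<open>\<beta>\<close> makes that a convergent geometric
  series, as \<open>exp (1/2) < 2\<close>.\<close>

lemma summable_gp_coeff_exp:
  assumes "0 \<le> \<beta>" "\<beta> \<le> 1/6" "0 \<le> \<alpha>"
  shows "summable (\<lambda>k. gp_coeff \<beta> k \<alpha> * exp (\<alpha> + real k * \<beta>))"
proof (rule summable_comparison_test)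
  have bound: "gp_coeff \<beta> k \<alpha> * exp (\<alpha> + real k * \<beta>) \<le> exp (3 * \<alpha>) * (exp (1/2) / 2) ^ k" for k
  proof -
    define z where "z = \<alpha> + real k * \<beta>"
    have z: "0 \<le> z" "\<alpha> \<le> z" using assms by (auto simp: z_def)
    have "gp_coeff \<beta> k \<alpha> \<le> z ^ k / fact k"
    proof (cases k)
      case (Suc j)
      have "\<alpha> * z ^ j \<le> z * z ^ j" using z by (intro mult_right_mono) auto
      then show ?thesis using Suc by (simp add: gp_coeff_def z_def divide_right_mono)
    qed (simp add: gp_coeff_def)
    also have "z ^ k / fact k \<le> exp (2 * z) / 2 ^ k"
      using power_le_fact_exp[of "2 * z" k] z by (simp add: field_simps)
    finally have "gp_coeff \<beta> k \<alpha> * exp z \<le> exp (2 * z) / 2 ^ k * exp z"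
      by (intro mult_right_mono) auto
    also have "\<dots> = exp (3 * z) / 2 ^ k"
      by (simp add: exp_add[symmetric])
    also have "\<dots> \<le> exp (3 * \<alpha> + real k * (1/2)) / 2 ^ k"
      using mult_left_mono[OF assms(2), of "real k"]
      by (intro divide_right_mono) (auto simp: z_def algebra_simps)
    also have "\<dots> = exp (3 * \<alpha>) * (exp (1/2) / 2) ^ k"
      unfolding exp_add exp_of_nat_mult by (simp add: power_divide)
    finally show ?thesis by (simp add: z_def)
  qed
  show "\<exists>N. \<forall>n\<ge>N. norm (gp_coeff \<beta> n \<alpha> * exp (\<alpha> + real n * \<beta>)) \<le> exp (3 * \<alpha>) * (exp (1/2) / 2) ^ n"
    using bound gp_coeff_nonneg[OF assms(1,3)] by (auto simp: abs_mult)
  have "exp (1/2 :: real) < 2"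
  proof (rule power2_less_imp_less)
    show "(exp (1/2 :: real))\<^sup>2 < 2\<^sup>2"
      using exp_le by (simp add: power2_eq_square exp_add[symmetric])
  qed simp
  then show "summable (\<lambda>k. exp (3 * \<alpha>) * (exp (1/2 :: real) / 2) ^ k)"
    by (intro summable_mult summable_geometric) simp
qed

text \<open>The powers \<open>z ^ (k - 1)\<close> and \<open>z ^ (m - k)\<close> with \<open>z = \<alpha> + k * \<beta>\<close> combine to \<open>z ^ (m - 1)\<close>, whose
  exponent does not depend on \<open>k\<close>, so a diagonal is an alternating binomial sum of degree
  \<open>m - 1\<close>.\<close>

lemma gp_coeff_diagonal_sum:
  "(\<Sum>k\<le>m. gp_coeff \<beta> k \<alpha> * ((- (\<alpha> + real k * \<beta>)) ^ (m - k) / fact (m - k)))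
     = (if m = 0 then 1 else 0)"
proof (cases m)
  case (Suc d)
  have "gp_coeff \<beta> k \<alpha> * ((- (\<alpha> + real k * \<beta>)) ^ (m - k) / fact (m - k))
      = \<alpha> * (-1) ^ m / fact m * ((-1) ^ k * real (m choose k) * (\<alpha> + real k * \<beta>) ^ d)"
    if "k \<le> m" for k
  proof -
    define z where "z = \<alpha> + real k * \<beta>"
    have sign: "(- z) ^ (m - k) = (-1) ^ m * (-1) ^ k * z ^ (m - k)"
      using that by (subst power_minus) (simp add: power_add[symmetric] minus_one_power_iff)
    have powers: "(if k = 0 then 1 else \<alpha> * z ^ (k - 1)) * z ^ (m - k) = \<alpha> * z ^ d"
      using that Suc by (cases k) (auto simp: z_def power_add[symmetric])
    have "gp_coeff \<beta> k \<alpha> = (if k = 0 then 1 else \<alpha> * z ^ (k - 1)) / fact k"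
      by (simp add: gp_coeff_def z_def)
    then have "gp_coeff \<beta> k \<alpha> * ((- z) ^ (m - k) / fact (m - k))
        = (-1) ^ m * (-1) ^ k * ((if k = 0 then 1 else \<alpha> * z ^ (k - 1)) * z ^ (m - k))
            / (fact k * fact (m - k))"
      by (simp only: sign times_divide_times_eq mult_ac times_divide_eq_right times_divide_eq_left divide_divide_eq_left)
    also have "\<dots> = \<alpha> * (-1) ^ m / fact m * ((-1) ^ k * real (m choose k) * z ^ d)"
      unfolding powers using that by (simp add: binomial_fact)
    finally show ?thesis by (simp add: z_def)
  qed
  then have "(\<Sum>k\<le>m. gp_coeff \<beta> k \<alpha> * ((- (\<alpha> + real k * \<beta>)) ^ (m - k) / fact (m - k)))
      = \<alpha> * (-1) ^ m / fact m * (\<Sum>k\<le>m. (-1) ^ k * real (m choose k) * (\<alpha> + real k * \<beta>) ^ d)"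
    by (simp add: sum_distrib_left)
  then show ?thesis
    using alternating_binomial_sum_power_eq_0[of d m] Suc by simp
qed (simp add: gp_coeff_def)

text \<open>Summed by rows, the double series gives the total mass; summed by diagonals, only the term of
  degree zero survives.\<close>

lemma gen_poisson_sums_1:
  assumes "0 \<le> \<beta>" "\<beta> \<le> 1/6" "0 \<le> \<alpha>"
  shows "(\<lambda>k. gen_poisson \<beta> k \<alpha>) sums 1"
proof -
  define F where "F = (\<lambda>(k, j). gp_coeff \<beta> k \<alpha> * ((- (\<alpha> + real k * \<beta>)) ^ j / fact j))"
  have exp_has_sum: "((\<lambda>j. z ^ j / fact j) has_sum exp z) UNIV" for z :: real
    using summable_norm_exp[of z] exp_converges[of z]
    by (intro norm_summable_imp_has_sum) (simp_all add: divide_inverse mult.commute)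
  have "(\<lambda>p. norm (F p)) summable_on UNIV \<times> UNIV"
  proof (rule summable_on_SigmaI)
    show "((\<lambda>j. norm (F (k, j))) has_sum (gp_coeff \<beta> k \<alpha> * exp (\<alpha> + real k * \<beta>))) UNIV" for k
    proof -
      have "norm (F (k, j)) = gp_coeff \<beta> k \<alpha> * ((\<alpha> + real k * \<beta>) ^ j / fact j)" for j
        using assms gp_coeff_nonneg[OF assms(1,3), of k]
        by (simp add: F_def abs_mult power_abs del: minus_add_distrib)
      then show ?thesis
        by (simp only:) (intro has_sum_cmult_right exp_has_sum)
    qed
    show "(\<lambda>k. gp_coeff \<beta> k \<alpha> * exp (\<alpha> + real k * \<beta>)) summable_on UNIV"
      using summable_gp_coeff_exp[OF assms] gp_coeff_nonneg[OF assms(1,3)]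
      by (intro norm_summable_imp_summable_on) (simp add: abs_mult)
  qed auto
  then have "F summable_on UNIV \<times> UNIV"
    by (rule abs_summable_summable)
  then obtain S where S: "(F has_sum S) (UNIV \<times> UNIV)"
    by (auto simp: summable_on_def)
  have rows: "((\<lambda>k. gen_poisson \<beta> k \<alpha>) has_sum S) UNIV"
    using S
  proof (rule has_sum_SigmaD)
    show "((\<lambda>j. F (k, j)) has_sum gen_poisson \<beta> k \<alpha>) UNIV" for k
      unfolding F_def gen_poisson_eq_coeff prod.case
      by (intro has_sum_cmult_right exp_has_sum)
  qed
  have "((\<lambda>(m, k). F (k, m - k)) has_sum S) (SIGMA m:UNIV. {..m}) \<longleftrightarrow> (F has_sum S) (UNIV \<times> UNIV)"
    by (rule has_sum_reindex_bij_witness[where i = "\<lambda>(k, j). (k + j, k)" and j = "\<lambda>(m, k). (k, m - k)"]) auto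
  with S have "((\<lambda>(m, k). F (k, m - k)) has_sum S) (SIGMA m:UNIV. {..m})"
    by simp
  then have "((\<lambda>m::nat. if m = 0 then 1 else 0 :: real) has_sum S) UNIV"
  proof (rule has_sum_SigmaD)
    show "((\<lambda>k. case (m, k) of (m, k) \<Rightarrow> F (k, m - k)) has_sum (if m = 0 then 1 else 0)) {..m}" for m
      using gp_coeff_diagonal_sum[where m = m and \<alpha> = \<alpha> and \<beta> = \<beta>]
      by (intro has_sum_finiteI) (simp_all add: F_def)
  qed
  moreover have "((\<lambda>m::nat. if m = 0 then 1 else 0 :: real) has_sum 1) UNIV"
    by (rule has_sum_finite_neutralI[where B = "{0}"]) auto
  ultimately have "S = 1"
    by (rule has_sum_unique)
  with rows show ?thesis
    by (simp add: has_sum_imp_sums)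
qed

section \<open>Exponential moments by tilting\<close>

text \<open>Scaling both parameters by \<open>t\<close> is an exponential change of measure: the coefficient is
  homogeneous of degree \<open>k\<close>, and the exponent \<open>\<alpha> + k * \<beta>\<close> is linear in \<open>k\<close>.\<close>

lemma gen_poisson_tilt:
  assumes "0 < t"
  shows "gen_poisson (t * \<beta>) k (t * \<alpha>)
    = exp (- ((t - 1) * \<alpha>)) * (gen_poisson \<beta> k \<alpha> * exp ((ln t - (t - 1) * \<beta>) * real k))"
proof -
  have "gp_coeff (t * \<beta>) k (t * \<alpha>) = gp_coeff \<beta> k \<alpha> * t ^ k"
  proof (cases k)
    case (Suc j)
    have "t * \<alpha> + real k * (t * \<beta>) = t * (\<alpha> + real k * \<beta>)"
      by (simp add: algebra_simps)
    then show ?thesis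
      using Suc by (simp add: gp_coeff_def power_mult_distrib)
  qed (simp add: gp_coeff_def)
  also have "t ^ k = exp (ln t * real k)"
    using assms by (simp add: exp_of_nat2_mult)
  finally show ?thesis
    unfolding gen_poisson_eq_coeff by (simp add: exp_add[symmetric] algebra_simps)
qed

text \<open>The tilted weights are again generalised Poisson weights, so their total mass is one.\<close>

lemma gen_poisson_exponential_moment:
  assumes "0 \<le> \<beta>" "0 < t" "t * \<beta> \<le> 1/6" "0 \<le> \<alpha>"
  shows "(\<lambda>k. gen_poisson \<beta> k \<alpha> * exp ((ln t - (t - 1) * \<beta>) * real k)) sums exp ((t - 1) * \<alpha>)"
proof -
  have "(\<lambda>k. gen_poisson (t * \<beta>) k (t * \<alpha>)) sums 1"
    using assms by (intro gen_poisson_sums_1) auto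
  then have "(\<lambda>k. exp ((t - 1) * \<alpha>) * gen_poisson (t * \<beta>) k (t * \<alpha>)) sums (exp ((t - 1) * \<alpha>) * 1)"
    by (rule sums_mult)
  then show ?thesis
    unfolding gen_poisson_tilt[OF assms(2)] by (simp add: exp_minus flip: mult.assoc)
qed

text \<open>To realise a prescribed exponent \<open>h\<close> in the previous lemma, solve for \<open>t = 1 + s\<close>; a solution
  exists in \<open>[0, 2 * h]\<close> by the intermediate value theorem. The enclosure of \<open>s\<close>, which comes from
  \<open>s - s\<^sup>2 \<le> ln (1 + s) \<le> s\<close>, shows that \<open>s\<close> is asymptotic to \<open>h\<close> as \<open>h\<close> and \<open>\<beta>\<close> tend to zero. The
  bounds \<open>1/12\<close> and \<open>s \<le> 1/6\<close> keep \<open>(1 + s) * \<beta>\<close> below \<open>1/6\<close>.\<close>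

lemma tilt_parameter:
  fixes \<beta> h :: real
  assumes "0 \<le> \<beta>" "\<beta> \<le> 1/12" "0 \<le> h" "h \<le> 1/12"
  obtains s where "0 \<le> s" "s \<le> 1/6" "ln (1 + s) - s * \<beta> = h"
    "h / (1 - \<beta>) \<le> s" "s \<le> h / (1 - \<beta> - 2 * h)"
proof -
  have "2 * h * (1/2) \<le> 2 * h * (1 - 2 * h - \<beta>)"
    using assms by (intro mult_left_mono) auto
  also have "\<dots> = 2 * h - (2 * h)\<^sup>2 - 2 * h * \<beta>"
    by (simp add: power2_eq_square algebra_simps)
  also have "\<dots> \<le> ln (1 + 2 * h) - 2 * h * \<beta>"
    using ln_one_plus_pos_lower_bound[of "2 * h"] assms by simp
  finally have upper: "h \<le> ln (1 + 2 * h) - 2 * h * \<beta>" by simp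
  have "\<exists>s\<ge>0. s \<le> 2 * h \<and> ln (1 + s) - s * \<beta> = h"
    using assms upper by (intro IVT') (auto intro!: continuous_intros)
  then obtain s where s: "0 \<le> s" "s \<le> 2 * h" "ln (1 + s) - s * \<beta> = h" by blast
  have "ln (1 + s) \<le> s"
    using s by (intro ln_add_one_self_le_self) 
  then have "h \<le> s * (1 - \<beta>)"
    using s by (simp add: algebra_simps)
  moreover have "s - s\<^sup>2 \<le> ln (1 + s)"
    using s assms by (intro ln_one_plus_pos_lower_bound) auto
  then have "s * (1 - \<beta> - s) \<le> h"
    using s by (simp add: algebra_simps power2_eq_square)
  moreover have "s * (1 - \<beta> - 2 * h) \<le> s * (1 - \<beta> - s)"
    using s by (intro mult_left_mono) auto
  ultimately show ?thesis
    using that[of s] s assms by (auto simp: field_simps)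
qed

section \<open>Limits of the exponential moments\<close>

lemma abs_exp_diff_le:
  fixes u v B :: real
  assumes "u \<le> B" "v \<le> B"
  shows "\<bar>exp u - exp v\<bar> \<le> exp B * \<bar>u - v\<bar>"
proof -
  have step: "exp w - exp z \<le> exp B * (w - z)" if "z \<le> w" "w \<le> B" for w z :: real
  proof -
    have "exp w * (1 + (z - w)) \<le> exp w * exp (z - w)"
      by (intro mult_left_mono exp_ge_add_one_self) auto
    then have "exp w - exp z \<le> exp w * (w - z)"
      by (simp add: exp_add[symmetric] algebra_simps)
    also have "\<dots> \<le> exp B * (w - z)"
      using that by (intro mult_right_mono) auto
    finally show ?thesis .
  qed
  show ?thesis
    using step[of v u] step[of u v] assms by (cases "v \<le> u") auto
qed

lemma uniform_limit_exp_rate: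
  fixes r :: "nat \<Rightarrow> real"
  assumes "r \<longlonglongrightarrow> c" "0 \<le> c"
  shows "uniform_limit {0..X} (\<lambda>n x. exp (r n * x)) (\<lambda>x. exp (c * x)) sequentially"
proof (rule uniform_limitI)
  fix e :: real assume "0 < e"
  have "(\<lambda>n. exp ((c + 1) * X) * (\<bar>r n - c\<bar> * X)) \<longlonglongrightarrow> exp ((c + 1) * X) * (\<bar>c - c\<bar> * X)"
    by (intro tendsto_intros assms)
  then have "\<forall>\<^sub>F n in sequentially. exp ((c + 1) * X) * (\<bar>r n - c\<bar> * X) < e"
    using \<open>0 < e\<close> by (intro order_tendstoD(2)) auto
  moreover have "\<forall>\<^sub>F n in sequentially. r n < c + 1"
    using assms by (intro order_tendstoD(2)) auto
  ultimately show "\<forall>\<^sub>F n in sequentially. \<forall>x\<in>{0..X}. dist (exp (r n * x)) (exp (c * x)) < e"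
  proof eventually_elim
    case (elim n)
    show ?case
    proof
      fix x assume x: "x \<in> {0..X}"
      have "r n * x \<le> (c + 1) * X" "c * x \<le> (c + 1) * X"
        using x elim assms by (auto intro!: mult_mono)
      then have "\<bar>exp (r n * x) - exp (c * x)\<bar> \<le> exp ((c + 1) * X) * \<bar>r n * x - c * x\<bar>"
        by (rule abs_exp_diff_le)
      also have "\<bar>r n * x - c * x\<bar> = \<bar>r n - c\<bar> * x"
        using x by (simp add: abs_mult left_diff_distrib[symmetric])
      also have "exp ((c + 1) * X) * (\<bar>r n - c\<bar> * x) \<le> exp ((c + 1) * X) * (\<bar>r n - c\<bar> * X)"
        using x by (intro mult_left_mono) auto
      finally show "dist (exp (r n * x)) (exp (c * x)) < e"
        using elim by (simp add: dist_real_def)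
    qed
  qed
qed

text \<open>In operator terms, \<open>J\<close> maps \<open>\<lambda>y. exp (c * y)\<close> to the exponential with rate \<open>r n\<close>, and the rates
  converge to \<open>c\<close>: with \<open>s n\<close> the tilt for the exponent \<open>c / b n\<close>, the rate is \<open>a n * s n\<close>, which is
  squeezed between two multiples of \<open>a n / b n\<close>.\<close>

lemma gen_poisson_exponential_moment_limit:
  fixes a b \<beta> :: "nat \<Rightarrow> real"
  assumes ab: "(\<lambda>n. a n / b n) \<longlonglongrightarrow> 1" and b: "filterlim b at_top sequentially"
    and \<beta>: "\<beta> \<longlonglongrightarrow> 0" "\<forall>\<^sub>F n in sequentially. 0 \<le> \<beta> n" and c: "0 \<le> c"
  obtains r where "r \<longlonglongrightarrow> c"
    "\<forall>\<^sub>F n in sequentially. \<forall>x\<ge>0.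
       (\<lambda>k. gen_poisson (\<beta> n) k (a n * x) * exp (c * (real k / b n))) sums exp (r n * x)"
proof -
  have h: "(\<lambda>n. c / b n) \<longlonglongrightarrow> 0"
    by (rule real_tendsto_divide_at_top[OF tendsto_const b])
  have b_pos: "\<forall>\<^sub>F n in sequentially. 0 < b n"
    using b by (simp add: filterlim_at_top_dense)
  have ab_pos: "\<forall>\<^sub>F n in sequentially. 0 < a n / b n"
    using ab by (rule order_tendstoD) simp
  have h_small: "\<forall>\<^sub>F n in sequentially. c / b n < 1/12"
    using h by (rule order_tendstoD) simp
  have \<beta>_small: "\<forall>\<^sub>F n in sequentially. \<beta> n < 1/12"
    using \<beta>(1) by (rule order_tendstoD) simp
  have "\<forall>\<^sub>F n in sequentially. \<exists>s. 0 \<le> s \<and> s \<le> 1/6 \<and> ln (1 + s) - s * \<beta> n = c / b n \<and>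
      (c / b n) / (1 - \<beta> n) \<le> s \<and> s \<le> (c / b n) / (1 - \<beta> n - 2 * (c / b n))"
    using b_pos h_small \<beta>_small \<beta>(2)
  proof eventually_elim
    case (elim n)
    then show ?case
      using c tilt_parameter[of "\<beta> n" "c / b n"] by (metis divide_nonneg_pos less_imp_le)
  qed
  then obtain s where s: "\<forall>\<^sub>F n in sequentially. 0 \<le> s n \<and> s n \<le> 1/6 \<and>
      ln (1 + s n) - s n * \<beta> n = c / b n \<and>
      (c / b n) / (1 - \<beta> n) \<le> s n \<and> s n \<le> (c / b n) / (1 - \<beta> n - 2 * (c / b n))"
    unfolding eventually_ex by blast
  have "(\<lambda>n. a n * s n) \<longlonglongrightarrow> c"
  proof (rule tendsto_sandwich)
    show "\<forall>\<^sub>F n in sequentially. c * (a n / b n) / (1 - \<beta> n) \<le> a n * s n"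
      using s ab_pos b_pos
    proof eventually_elim
      case (elim n)
      then have "0 \<le> a n" by (simp add: zero_less_divide_iff)
      then have "a n * ((c / b n) / (1 - \<beta> n)) \<le> a n * s n"
        using elim by (intro mult_left_mono) auto
      then show ?case by (simp add: mult_ac)
    qed
    show "\<forall>\<^sub>F n in sequentially. a n * s n \<le> c * (a n / b n) / (1 - \<beta> n - 2 * (c / b n))"
      using s ab_pos b_pos
    proof eventually_elim
      case (elim n)
      then have "0 \<le> a n" by (simp add: zero_less_divide_iff)
      then have "a n * s n \<le> a n * ((c / b n) / (1 - \<beta> n - 2 * (c / b n)))"
        using elim by (intro mult_left_mono) auto
      then show ?case by (simp add: mult_ac)
    qed
    have "(\<lambda>n. c * (a n / b n) / (1 - \<beta> n)) \<longlonglongrightarrow> c * 1 / (1 - 0)"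
      by (intro tendsto_intros ab \<beta>) auto
    then show "(\<lambda>n. c * (a n / b n) / (1 - \<beta> n)) \<longlonglongrightarrow> c" by simp
    have "(\<lambda>n. c * (a n / b n) / (1 - \<beta> n - 2 * (c / b n))) \<longlonglongrightarrow> c * 1 / (1 - 0 - 2 * 0)"
      by (intro tendsto_intros ab \<beta> h) auto
    then show "(\<lambda>n. c * (a n / b n) / (1 - \<beta> n - 2 * (c / b n))) \<longlonglongrightarrow> c" by simp
  qed
  moreover have "\<forall>\<^sub>F n in sequentially. \<forall>x\<ge>0.
      (\<lambda>k. gen_poisson (\<beta> n) k (a n * x) * exp (c * (real k / b n))) sums exp (a n * s n * x)"
    using s ab_pos b_pos \<beta>_small \<beta>(2)
  proof eventually_elim
    case (elim n)
    then have "0 \<le> a n" by (simp add: zero_less_divide_iff)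
    moreover have "(1 + s n) * \<beta> n \<le> 2 * (1/12)"
      using elim by (intro mult_mono) auto
    ultimately show ?case
      using gen_poisson_exponential_moment[of "\<beta> n" "1 + s n" "a n * x" for x] elim
      by (auto simp: mult_ac)
  qed
  ultimately show ?thesis by (rule that)
qed

section \<open>Functions of polynomial growth\<close>

lemma C_imp_continuous_on:
  assumes "f \<in> C p"
  shows "continuous_on {0..} f"
proof -
  have "continuous_on {0..} (\<lambda>x. f x * weight p x)"
    using assms by (simp add: C_def uniformly_continuous_imp_continuous)
  moreover have "continuous_on {0..} (\<lambda>x. if p = 0 then 1 else 1 + x ^ p :: real)"
    by (cases "p = 0") (auto intro!: continuous_intros)
  ultimately have "continuous_on {0..} (\<lambda>x. f x * weight p x * (if p = 0 then 1 else 1 + x ^ p))"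
    by (rule continuous_on_mult)
  then show ?thesis
  proof (rule continuous_on_eq)
    fix x :: real assume "x \<in> {0..}"
    then have "0 \<le> x ^ p" by simp
    then have "1 + x ^ p \<noteq> 0" by linarith
    then show "f x * weight p x * (if p = 0 then 1 else 1 + x ^ p) = f x"
      by (simp add: weight_def)
  qed
qed

lemma C_imp_exponential_bound:
  assumes "f \<in> C p"
  obtains M where "0 \<le> M" "\<And>y. 0 \<le> y \<Longrightarrow> \<bar>f y\<bar> \<le> M * exp y"
proof -
  obtain B where B: "\<And>x. 0 \<le> x \<Longrightarrow> \<bar>f x * weight p x\<bar> \<le> B"
    using assms by (auto simp: C_def bounded_iff)
  have "0 \<le> B" using B[of 0] by linarith
  show ?thesis
  proof
    show "0 \<le> B * (1 + fact p)" using \<open>0 \<le> B\<close> by simp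
    fix y :: real assume y: "0 \<le> y"
    have "\<bar>f y\<bar> \<le> B * (1 + y ^ p)"
    proof (cases "p = 0")
      case True
      then show ?thesis using B[OF y] \<open>0 \<le> B\<close> by (simp add: weight_def)
    next
      case False
      then show ?thesis
        using B[OF y] zero_le_power[OF y, of p] by (simp add: weight_def field_simps)
    qed
    also have "1 + y ^ p \<le> (1 + fact p) * exp y"
      using power_le_fact_exp[OF y, of p] y by (simp add: distrib_right add_mono)
    finally show "\<bar>f y\<bar> \<le> B * (1 + fact p) * exp y"
      using \<open>0 \<le> B\<close> by (simp add: mult_left_mono mult.assoc)
  qed
qed

text \<open>Near \<open>x\<close>, uniform continuity gives the bound \<open>e\<close>. Once \<open>y\<close> is at distance at least \<open>d\<close> from \<open>x\<close>,
  the gap \<open>\<bar>exp y - exp x\<bar>\<close> is at least \<open>1 - exp (- d)\<close> times the larger of the two exponentials, so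
  its square dominates the growth of \<open>f\<close>. Taking continuity on \<open>{0..X + 1}\<close> and \<open>d \<le> 1\<close> covers
  the points \<open>y\<close> beyond \<open>X\<close> that are close to \<open>x\<close>.\<close>

lemma increment_le_exp_square:
  fixes f :: "real \<Rightarrow> real"
  assumes cont: "continuous_on {0..} f" and M: "0 \<le> M" "\<And>y. 0 \<le> y \<Longrightarrow> \<bar>f y\<bar> \<le> M * exp y"
    and "0 < e"
  obtains K where "0 \<le> K"
    "\<And>x y. 0 \<le> x \<Longrightarrow> x \<le> X \<Longrightarrow> 0 \<le> y \<Longrightarrow> \<bar>f y - f x\<bar> \<le> e + K * (exp y - exp x)\<^sup>2"
proof -
  have "uniformly_continuous_on {0..X + 1} f"
    by (rule compact_uniformly_continuous[OF continuous_on_subset[OF cont]]) auto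
  then obtain d0 where d0: "0 < d0"
    "\<And>x y. x \<in> {0..X + 1} \<Longrightarrow> y \<in> {0..X + 1} \<Longrightarrow> dist y x < d0 \<Longrightarrow> dist (f y) (f x) < e"
    using \<open>0 < e\<close> by (metis uniformly_continuous_on_def)
  define d where "d = min d0 1"
  have d: "0 < d" "d \<le> d0" "d \<le> 1" using d0 by (auto simp: d_def)
  define q where "q = 1 - exp (- d)"
  have q: "0 < q" using d by (simp add: q_def)
  show ?thesis
  proof
    show "0 \<le> 2 * M / q\<^sup>2" using M by simp
    fix x y :: real assume x: "0 \<le> x" "x \<le> X" and y: "0 \<le> y"
    show "\<bar>f y - f x\<bar> \<le> e + 2 * M / q\<^sup>2 * (exp y - exp x)\<^sup>2"
    proof (cases "\<bar>y - x\<bar> < d")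
      case True
      then have "dist (f y) (f x) < e"
        using x y d by (intro d0(2)) (auto simp: dist_real_def)
      moreover have "0 \<le> 2 * M / q\<^sup>2 * (exp y - exp x)\<^sup>2" using M by simp
      ultimately show ?thesis by (simp add: dist_real_def)
    next
      case False
      define m where "m = max x y"
      have gap: "q * exp v \<le> exp v - exp u" if "u + d \<le> v" for u v :: real
      proof -
        have "exp u \<le> exp (v - d)" using that by simp
        then show ?thesis by (simp add: q_def exp_diff exp_minus field_simps)
      qed
      have "q * exp m \<le> \<bar>exp y - exp x\<bar>"
        using False d gap[of x y] gap[of y x] by (auto simp: m_def max_def abs_if split: if_splits)
      then have "(q * exp m)\<^sup>2 \<le> (exp y - exp x)\<^sup>2"
        using q by (intro abs_le_square_iff[THEN iffD1]) simp
      then have square: "exp m * exp m \<le> (exp y - exp x)\<^sup>2 / q\<^sup>2"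
        using q by (simp add: field_simps power2_eq_square)
      have "\<bar>f y - f x\<bar> \<le> M * exp y + M * exp x"
        using M(2)[OF y] M(2)[OF x(1)] by linarith
      also have "\<dots> \<le> M * exp m + M * exp m"
        using M(1) by (intro add_mono mult_left_mono) (auto simp: m_def)
      also have "\<dots> = 2 * M * (1 * exp m)" by simp
      also have "\<dots> \<le> 2 * M * (exp m * exp m)"
        using M(1) x by (intro mult_left_mono mult_right_mono) (auto simp: m_def)
      also have "\<dots> \<le> 2 * M * ((exp y - exp x)\<^sup>2 / q\<^sup>2)"
        using M(1) by (intro mult_left_mono square) auto
      finally show ?thesis using \<open>0 < e\<close> by simp
    qed
  qed
qed

section \<open>The Korovkin estimate and convergence\<close>

text \<open>As the weights are nonnegative with total mass one, an inequality for the increments of \<open>f\<close>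
  can be integrated against them; the majorant is a combination of the three test functions.\<close>

lemma J_error_le:
  assumes \<beta>: "0 \<le> \<beta>" "\<beta> \<le> 1/6" and A: "0 \<le> A * x" and B: "0 \<le> B"
    and E1: "(\<lambda>k. gen_poisson \<beta> k (A * x) * exp (real k / B)) sums E1"
    and E2: "(\<lambda>k. gen_poisson \<beta> k (A * x) * exp (2 * (real k / B))) sums E2"
    and f: "\<And>y. 0 \<le> y \<Longrightarrow> \<bar>f y - f x\<bar> \<le> e + K * (exp y - exp x)\<^sup>2"
  shows "\<bar>J \<beta> f A B x - f x\<bar> \<le> e + K * (E2 - 2 * exp x * E1 + exp (2 * x))"
proof -
  let ?w = "\<lambda>k. gen_poisson \<beta> k (A * x)"
  have mass: "?w sums 1" using \<beta> A by (rule gen_poisson_sums_1)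
  have "(\<lambda>k. (e + K * exp (2 * x)) * ?w k + K * (?w k * exp (2 * (real k / B)))
        - 2 * K * exp x * (?w k * exp (real k / B)))
      sums ((e + K * exp (2 * x)) * 1 + K * E2 - 2 * K * exp x * E1)"
    by (intro sums_add sums_diff sums_mult mass E1 E2)
  also have "(\<lambda>k. (e + K * exp (2 * x)) * ?w k + K * (?w k * exp (2 * (real k / B)))
        - 2 * K * exp x * (?w k * exp (real k / B)))
      = (\<lambda>k. ?w k * (e + K * (exp (real k / B) - exp x)\<^sup>2))"
    by (simp only: exp_double power2_diff) (simp add: fun_eq_iff algebra_simps)
  finally have majorant: "(\<lambda>k. ?w k * (e + K * (exp (real k / B) - exp x)\<^sup>2))
      sums (e + K * (E2 - 2 * exp x * E1 + exp (2 * x)))"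
    by (simp add: algebra_simps)
  have bound: "norm (?w k * (f (real k / B) - f x)) \<le> ?w k * (e + K * (exp (real k / B) - exp x)\<^sup>2)" for k
    using f[of "real k / B"] gen_poisson_nonneg[OF \<beta>(1) A, of k] B
    by (simp add: abs_mult mult_left_mono)
  have "summable (\<lambda>k. ?w k * (f (real k / B) - f x))"
    using sums_summable[OF majorant] bound by (rule summable_comparison_test'[where N = 0])
  then have diff: "(\<lambda>k. ?w k * (f (real k / B) - f x)) sums (\<Sum>k. ?w k * (f (real k / B) - f x))"
    by (rule summable_sums)
  have "(\<lambda>k. ?w k * (f (real k / B) - f x) + f x * ?w k)
      sums ((\<Sum>k. ?w k * (f (real k / B) - f x)) + f x * 1)"
    by (intro sums_add sums_mult diff mass)
  then have "(\<lambda>k. ?w k * f (real k / B)) sums ((\<Sum>k. ?w k * (f (real k / B) - f x)) + f x)"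
    by (simp add: algebra_simps)
  then have "J \<beta> f A B x - f x = (\<Sum>k. ?w k * (f (real k / B) - f x))"
    unfolding J_def by (simp add: sums_iff)
  moreover have "norm (\<Sum>k. ?w k * (f (real k / B) - f x)) \<le> e + K * (E2 - 2 * exp x * E1 + exp (2 * x))"
    by (rule norm_sums_le[OF diff majorant bound])
  ultimately show ?thesis by simp
qed

text \<open>At \<open>x\<close>, the image of \<open>y \<mapsto> (exp y - exp x)\<^sup>2\<close> tends to zero uniformly on \<open>{0..X}\<close>, because the
  first two exponential moments converge uniformly there.\<close>

lemma uniform_limit_J:
  fixes a b \<beta> :: "nat \<Rightarrow> real"
  assumes ab: "(\<lambda>n. a n / b n) \<longlonglongrightarrow> 1" and b: "filterlim b at_top sequentially"
    and \<beta>: "\<beta> \<longlonglongrightarrow> 0" "\<forall>\<^sub>F n in sequentially. 0 \<le> \<beta> n" and f: "f \<in> C p"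
  shows "uniform_limit {0..X} (\<lambda>n x. J (\<beta> n) f (a n) (b n) x) f sequentially"
proof (rule uniform_limitI)
  fix e :: real assume "0 < e"
  obtain M where M: "0 \<le> M" "\<And>y. 0 \<le> y \<Longrightarrow> \<bar>f y\<bar> \<le> M * exp y"
    using C_imp_exponential_bound[OF f] by blast
  obtain K where K: "0 \<le> K"
    "\<And>x y. 0 \<le> x \<Longrightarrow> x \<le> X \<Longrightarrow> 0 \<le> y \<Longrightarrow> \<bar>f y - f x\<bar> \<le> e / 2 + K * (exp y - exp x)\<^sup>2"
    using increment_le_exp_square[OF C_imp_continuous_on[OF f] M, of "e / 2" X] \<open>0 < e\<close> by auto
  obtain r1 where r1: "r1 \<longlonglongrightarrow> 1" "\<forall>\<^sub>F n in sequentially. \<forall>x\<ge>0.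
       (\<lambda>k. gen_poisson (\<beta> n) k (a n * x) * exp (1 * (real k / b n))) sums exp (r1 n * x)"
    using gen_poisson_exponential_moment_limit[OF ab b \<beta>, of 1] by auto
  obtain r2 where r2: "r2 \<longlonglongrightarrow> 2" "\<forall>\<^sub>F n in sequentially. \<forall>x\<ge>0.
       (\<lambda>k. gen_poisson (\<beta> n) k (a n * x) * exp (2 * (real k / b n))) sums exp (r2 n * x)"
    using gen_poisson_exponential_moment_limit[OF ab b \<beta>, of 2] by auto
  \<comment> \<open>When both moments are within \<open>e / 2 / D\<close> of their limits, the quadratic part of the error is at
    most \<open>(D - 1) / D * (e / 2)\<close>; the summand \<open>1\<close> makes this strictly less than \<open>e / 2\<close> and keeps \<open>D\<close>
    positive even if \<open>K = 0\<close>.\<close>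
  define D where "D = K * (1 + 2 * exp X) + 1"
  have D: "0 < D" using K(1) by (simp add: D_def add_nonneg_pos)
  have close1: "\<forall>\<^sub>F n in sequentially. \<forall>x\<in>{0..X}. dist (exp (r1 n * x)) (exp (1 * x)) < e / 2 / D"
    using D \<open>0 < e\<close> by (intro uniform_limitD uniform_limit_exp_rate r1) auto
  have close2: "\<forall>\<^sub>F n in sequentially. \<forall>x\<in>{0..X}. dist (exp (r2 n * x)) (exp (2 * x)) < e / 2 / D"
    using D \<open>0 < e\<close> by (intro uniform_limitD uniform_limit_exp_rate r2) auto
  have b_pos: "\<forall>\<^sub>F n in sequentially. 0 < b n"
    using b by (simp add: filterlim_at_top_dense)
  have ab_pos: "\<forall>\<^sub>F n in sequentially. 0 < a n / b n"
    using ab by (rule order_tendstoD) simp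
  have \<beta>_small: "\<forall>\<^sub>F n in sequentially. \<beta> n < 1/6"
    using \<beta>(1) by (rule order_tendstoD) simp
  show "\<forall>\<^sub>F n in sequentially. \<forall>x\<in>{0..X}. dist (J (\<beta> n) f (a n) (b n) x) (f x) < e"
    using r1(2) r2(2) close1 close2 b_pos ab_pos \<beta>_small \<beta>(2)
  proof eventually_elim
    case (elim n)
    have a: "0 \<le> a n" using elim by (simp add: zero_less_divide_iff)
    show ?case
    proof
      fix x assume x: "x \<in> {0..X}"
      let ?V = "exp (r2 n * x) - 2 * exp x * exp (r1 n * x) + exp (2 * x)"
      have "\<bar>J (\<beta> n) f (a n) (b n) x - f x\<bar> \<le> e / 2 + K * ?V"
      proof (rule J_error_le)
        show "0 \<le> \<beta> n" "\<beta> n \<le> 1/6" "0 \<le> b n" "0 \<le> a n * x"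
          using elim(5,7,8) x a by simp_all
        show "(\<lambda>k. gen_poisson (\<beta> n) k (a n * x) * exp (real k / b n)) sums exp (r1 n * x)"
          "(\<lambda>k. gen_poisson (\<beta> n) k (a n * x) * exp (2 * (real k / b n))) sums exp (r2 n * x)"
          using elim(1,2) x by simp_all
        show "\<bar>f y - f x\<bar> \<le> e / 2 + K * (exp y - exp x)\<^sup>2" if "0 \<le> y" for y
          using K(2) x that by simp
      qed
      \<comment> \<open>The limit of \<open>?V\<close> is \<open>exp (2 * x) - 2 * exp x * exp x + exp (2 * x) = 0\<close>, so \<open>?V\<close> is a
        combination of the deviations of the two moments from their limits.\<close>
      also have "?V = (exp (r2 n * x) - exp (2 * x)) + 2 * exp x * (exp (1 * x) - exp (r1 n * x))"
        by (simp add: exp_double power2_eq_square right_diff_distrib)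
      also have "\<dots> \<le> e / 2 / D + 2 * exp X * (e / 2 / D)"
      proof (rule add_mono)
        show "exp (r2 n * x) - exp (2 * x) \<le> e / 2 / D"
          using elim(4) x by (fastforce simp: dist_real_def)
        have "dist (exp (r1 n * x)) (exp (1 * x)) < e / 2 / D"
          using elim(3) x by blast
        then have "2 * exp x * (exp (1 * x) - exp (r1 n * x)) \<le> 2 * exp x * (e / 2 / D)"
          by (intro mult_left_mono) (auto simp: dist_real_def)
        also have "\<dots> \<le> 2 * exp X * (e / 2 / D)"
          using x D \<open>0 < e\<close> by (intro mult_right_mono) auto
        finally show "2 * exp x * (exp (1 * x) - exp (r1 n * x)) \<le> 2 * exp X * (e / 2 / D)" .
      qed
      finally have "\<bar>J (\<beta> n) f (a n) (b n) x - f x\<bar>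
          \<le> e / 2 + K * (e / 2 / D + 2 * exp X * (e / 2 / D))"
        using K(1) by (simp add: mult_left_mono)
      also have "K * (e / 2 / D + 2 * exp X * (e / 2 / D)) = K * (1 + 2 * exp X) * (e / 2 / D)"
        by (simp only: distrib_left distrib_right mult_1_left mult.assoc)
      also have "\<dots> = (D - 1) / D * (e / 2)"
        by (simp add: D_def)
      also have "\<dots> < 1 * (e / 2)"
        using D \<open>0 < e\<close> by (intro mult_strict_right_mono) auto
      finally show "dist (J (\<beta> n) f (a n) (b n) x) (f x) < e"
        by (simp add: dist_real_def)
    qed
  qed
qed

lemma unbounded_mono_on_imp_at_top:
  fixes b :: "nat \<Rightarrow> real"
  assumes mono: "mono_on {m..} b" and unbdd: "\<not> bdd_above (b ` {m..})"
  shows "filterlim b at_top sequentially"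
  unfolding filterlim_at_top
proof
  fix Z
  obtain N where N: "N \<ge> m" "Z \<le> b N"
    using unbdd unfolding bdd_above_def by (auto simp: not_le intro: less_imp_le)
  show "\<forall>\<^sub>F n in sequentially. Z \<le> b n"
    using eventually_ge_at_top[of N]
  proof eventually_elim
    case (elim n)
    then have "b N \<le> b n" using N by (intro mono_onD[OF mono]) auto
    with N show ?case by simp
  qed
qed

theorem corollary2:
  fixes a b \<beta> :: "nat \<Rightarrow> real" and p :: nat and f :: "real \<Rightarrow> real"
  assumes "strict_mono_on {1..} a" and "\<not> bdd_above (a ` {1..})" and "\<And>n. n \<ge> 1 \<Longrightarrow> a n \<ge> 1"
    and "strict_mono_on {1..} b" and "\<not> bdd_above (b ` {1..})" and "\<And>n. n \<ge> 1 \<Longrightarrow> b n \<ge> 1"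
    and "mono_on {1..} (\<lambda>n. a n / b n)"
    and "(\<lambda>n. a n / b n - 1) \<in> o(\<lambda>n. 1 / b n)"
    and "f \<in> C p"
    and "\<And>n. n \<ge> 1 \<Longrightarrow> 0 \<le> \<beta> n \<and> \<beta> n < 1" and "\<beta> \<longlonglongrightarrow> 0"
  shows "(\<forall>x\<ge>0. (\<lambda>n. J (\<beta> n) f (a n) (b n) x) \<longlonglongrightarrow> f x) \<and>
         (\<forall>x1 x2. 0 \<le> x1 \<and> x1 < x2 \<longrightarrow>
            uniform_limit {x1..x2} (\<lambda>n x. J (\<beta> n) f (a n) (b n) x) f sequentially)"
proof -
  have b_top: "filterlim b at_top sequentially"
    using assms(4,5) by (intro unbounded_mono_on_imp_at_top strict_mono_on_imp_mono_on)
  have "((\<lambda>n. (a n / b n - 1) / (1 / b n)) \<longlongrightarrow> 0) sequentially"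
    using assms(8) by (rule smalloD_tendsto)
  then have "((\<lambda>n. (a n / b n - 1) / (1 / b n) / b n) \<longlongrightarrow> 0) sequentially"
    using b_top by (rule real_tendsto_divide_at_top)
  moreover have "\<forall>\<^sub>F n in sequentially. (a n / b n - 1) / (1 / b n) / b n = a n / b n - 1"
    using eventually_ge_at_top[of 1]
  proof eventually_elim
    case (elim n)
    then show ?case using assms(6)[of n] by (simp add: field_simps)
  qed
  ultimately have "(\<lambda>n. a n / b n - 1) \<longlonglongrightarrow> 0"
    by (simp add: tendsto_cong)
  then have ab: "(\<lambda>n. a n / b n) \<longlonglongrightarrow> 1"
    by (rule LIM_zero_cancel)
  have \<beta>_nonneg: "\<forall>\<^sub>F n in sequentially. 0 \<le> \<beta> n"
    using eventually_ge_at_top[of 1] by (rule eventually_mono) (use assms(10) in blast)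
  have unif: "uniform_limit {0..X} (\<lambda>n x. J (\<beta> n) f (a n) (b n) x) f sequentially" for X
    using ab b_top assms(11) \<beta>_nonneg assms(9) by (rule uniform_limit_J)
  show ?thesis
  proof (intro conjI allI impI)
    show "(\<lambda>n. J (\<beta> n) f (a n) (b n) x) \<longlonglongrightarrow> f x" if "x \<ge> 0" for x
      using tendsto_uniform_limitI[OF unif[of x], of x] that by simp
    show "uniform_limit {x1..x2} (\<lambda>n x. J (\<beta> n) f (a n) (b n) x) f sequentially"
      if "0 \<le> x1 \<and> x1 < x2" for x1 x2
      using that by (intro uniform_limit_on_subset[OF unif[of x2]]) auto
  qed
qed

end
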